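(* Let $k$ be an algebraically closed field of characteristic $0$ and let $\kappa$ be its cardinality. There exists an antichain $\mathcal C$ (with respect to $\le_p$) in $\bigcup_{m\ge 2}\Sigma_m$ such that, for every $m\ge 2$, $\mathcal C\cap\Sigma_m$ contains a non-empty open set of $\Sigma_m$. In particular, for every $m\ge 3$ the set $\mathcal C\cap\Sigma_m$ has cardinality $\kappa$.
   Context: For $A,B\subseteq k$, $A\le_p B$ means that there is a polynomial $P\in k[X]$ with $A=P^{-1}(B)$; $A\equiv_p B$ means $A\le_p B$ and $B\le_p A$; $[A]$ is the $\equiv_p$-class of $A$; $[A]\le_p[B]$ iff $A\le_p B$, which is a partial order on classes. $\mathcal P_n$ is the set of $n$-element subsets of $k$, and $\Sigma_n=\{[A]\mid A\in\mathcal P_n\}$. An antichain is a set of pairwise $\le_p$-incomparable classes. Two elements of $\mathcal P_n$ are $\equiv_p$-equivalent if and only if one is the image of the other under a linear polynomial $cX+c'$ with $c\neq 0$. Topology on $\Sigma_n$: let $D(f_n)\subseteq k^n$ be the Zariski open set of points with pairwise distinct coordinates. $\Sigma_n$ has the quotient topology of the Zariski topology of $D(f_n)$ with respect to the surjection $D(f_n)\to\Sigma_n$, $(a_1,\ldots,a_n)\mapsto[\{a_1,\ldots,a_n\}]$ (this is the Zariski topology of $\Sigma_n$ as an affine variety, the quotient of $D(f_n)$ by permutations of the coordinates and by the action of linear polynomials). *)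

theory Defs
  imports
    "HOL-Computational_Algebra.Polynomial"
    "HOL-Library.Poly_Mapping"
    "HOL-Library.Equipollence"
    "HOL-Analysis.Abstract_Topology"
begin

section \<open>Polynomial reducibility\<close>

definition poly_le :: "'a::field set \<Rightarrow> 'a set \<Rightarrow> bool"  (infix \<open>\<le>\<^sub>p\<close> 50)
  where "A \<le>\<^sub>p B \<longleftrightarrow> (\<exists>P :: 'a poly. A = poly P -` B)"

definition poly_equiv :: "'a::field set \<Rightarrow> 'a set \<Rightarrow> bool"  (infix \<open>\<equiv>\<^sub>p\<close> 50)
  where "A \<equiv>\<^sub>p B \<longleftrightarrow> A \<le>\<^sub>p B \<and> B \<le>\<^sub>p A"

definition pclass :: "'a::field set \<Rightarrow> 'a set set"
  where "pclass A = {B. A \<equiv>\<^sub>p B}"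

definition pclass_le :: "'a::field set set \<Rightarrow> 'a set set \<Rightarrow> bool"
  where "pclass_le X Y \<longleftrightarrow> (\<exists>A\<in>X. \<exists>B\<in>Y. A \<le>\<^sub>p B)"

definition pantichain :: "'a::field set set set \<Rightarrow> bool"
  where "pantichain \<C> \<longleftrightarrow>
    (\<forall>X\<in>\<C>. \<forall>Y\<in>\<C>. X \<noteq> Y \<longrightarrow> \<not> pclass_le X Y \<and> \<not> pclass_le Y X)"

lemma poly_le_refl: "A \<le>\<^sub>p A"
  unfolding poly_le_def by (rule exI[of _ "[:0, 1:]"]) auto

lemma poly_le_trans:
  assumes "A \<le>\<^sub>p B" "B \<le>\<^sub>p C"
  shows "A \<le>\<^sub>p C"
proof -
  obtain P Q where "A = poly P -` B" "B = poly Q -` C"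
    using assms unfolding poly_le_def by blast
  then have "A = poly (pcompose Q P) -` C"
    by (auto simp: poly_pcompose)
  then show ?thesis
    unfolding poly_le_def by blast
qed

lemma pclass_eq_iff: "pclass A = pclass B \<longleftrightarrow> A \<equiv>\<^sub>p B"
  unfolding pclass_def poly_equiv_def using poly_le_refl poly_le_trans by blast

lemma pclass_le_iff: "pclass_le (pclass A) (pclass B) \<longleftrightarrow> A \<le>\<^sub>p B"
  unfolding pclass_le_def pclass_def poly_equiv_def using poly_le_refl poly_le_trans by blast

definition n_subsets :: "nat \<Rightarrow> 'a set set"
  where "n_subsets n = {A. finite A \<and> card A = n}"

definition Sigma_classes :: "nat \<Rightarrow> 'a::field set set set"
  where "Sigma_classes n = pclass ` n_subsets n"


section \<open>The Zariski topology on affine space\<close>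

text \<open>
  Multivariate polynomials are finitely supported maps from monomials (finitely supported
  exponent vectors) to coefficients. A point of affine n-space is a list of length n, whose
  entry \<open>a ! i\<close> is the value of the variable with index i.
\<close>

definition monom_value :: "'a::comm_ring_1 list \<Rightarrow> (nat \<Rightarrow>\<^sub>0 nat) \<Rightarrow> 'a"
  where "monom_value a m = (\<Prod>i\<in>Poly_Mapping.keys m. (a ! i) ^ Poly_Mapping.lookup m i)"

definition mpoly_eval :: "'a::comm_ring_1 list \<Rightarrow> ((nat \<Rightarrow>\<^sub>0 nat) \<Rightarrow>\<^sub>0 'a) \<Rightarrow> 'a"
  where "mpoly_eval a p =
    (\<Sum>m\<in>Poly_Mapping.keys p. Poly_Mapping.lookup p m * monom_value a m)"

definition mpolys :: "nat \<Rightarrow> ((nat \<Rightarrow>\<^sub>0 nat) \<Rightarrow>\<^sub>0 'a::comm_ring_1) set"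
  where "mpolys n = {p. \<forall>m\<in>Poly_Mapping.keys p. Poly_Mapping.keys m \<subseteq> {..<n}}"

definition zero_locus ::
    "nat \<Rightarrow> ((nat \<Rightarrow>\<^sub>0 nat) \<Rightarrow>\<^sub>0 'a::comm_ring_1) set \<Rightarrow> 'a list set"
  where "zero_locus n S = {a. length a = n \<and> (\<forall>p\<in>S. mpoly_eval a p = 0)}"

definition zariski :: "nat \<Rightarrow> 'a::idom list topology"
  where "zariski n =
    topology (\<lambda>U. \<exists>S\<subseteq>mpolys n. U = {a. length a = n} - zero_locus n S)"

lemma monom_value_superset:
  assumes "finite I" "Poly_Mapping.keys m \<subseteq> I"
  shows "monom_value a m = (\<Prod>i\<in>I. (a ! i) ^ Poly_Mapping.lookup m i)"
  unfolding monom_value_def using assms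
  by (intro prod.mono_neutral_left) (auto simp: in_keys_iff)

lemma monom_value_add: "monom_value a (m + l) = monom_value a m * monom_value a l"
proof -
  let ?I = "Poly_Mapping.keys m \<union> Poly_Mapping.keys l"
  have "monom_value a (m + l) = (\<Prod>i\<in>?I. (a ! i) ^ Poly_Mapping.lookup (m + l) i)"
    by (rule monom_value_superset) (auto simp: Poly_Mapping.keys_add)
  moreover have "monom_value a m = (\<Prod>i\<in>?I. (a ! i) ^ Poly_Mapping.lookup m i)"
    and "monom_value a l = (\<Prod>i\<in>?I. (a ! i) ^ Poly_Mapping.lookup l i)"
    by (rule monom_value_superset; auto)+
  ultimately show ?thesis
    by (simp add: lookup_add power_add prod.distrib)
qed

lemma mpoly_eval_superset:
  assumes "finite M" "Poly_Mapping.keys p \<subseteq> M"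
  shows "mpoly_eval a p = (\<Sum>m\<in>M. Poly_Mapping.lookup p m * monom_value a m)"
  unfolding mpoly_eval_def using assms
  by (intro sum.mono_neutral_left) (auto simp: in_keys_iff)

lemma mpoly_eval_add: "mpoly_eval a (p + q) = mpoly_eval a p + mpoly_eval a q"
proof -
  let ?M = "Poly_Mapping.keys p \<union> Poly_Mapping.keys q"
  have "mpoly_eval a (p + q) =
      (\<Sum>m\<in>?M. Poly_Mapping.lookup (p + q) m * monom_value a m)"
    by (rule mpoly_eval_superset) (use Poly_Mapping.keys_add[of p q] in auto)
  moreover have "mpoly_eval a p = (\<Sum>m\<in>?M. Poly_Mapping.lookup p m * monom_value a m)"
    and "mpoly_eval a q = (\<Sum>m\<in>?M. Poly_Mapping.lookup q m * monom_value a m)"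
    by (rule mpoly_eval_superset; auto)+
  ultimately show ?thesis
    by (simp add: lookup_add distrib_right sum.distrib)
qed

lemma mpoly_eval_single: "mpoly_eval a (Poly_Mapping.single m c) = c * monom_value a m"
  by (simp add: mpoly_eval_def)

lemma mpoly_eval_zero [simp]: "mpoly_eval a 0 = 0"
  by (simp add: mpoly_eval_def)

lemma mpoly_eval_one [simp]: "mpoly_eval a 1 = 1"
  by (simp add: mpoly_eval_def monom_value_def)

lemma mpoly_eval_sum: "mpoly_eval a (\<Sum>x\<in>X. f x) = (\<Sum>x\<in>X. mpoly_eval a (f x))"
  by (induction X rule: infinite_finite_induct) (auto simp: mpoly_eval_add)

lemma mpoly_sum_single:
  "p = (\<Sum>m\<in>Poly_Mapping.keys p. Poly_Mapping.single m (Poly_Mapping.lookup p m))"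
  by (rule poly_mapping_eqI) (auto simp: lookup_sum lookup_single when_def in_keys_iff)

lemma mpoly_eval_mult: "mpoly_eval a (p * q) = mpoly_eval a p * mpoly_eval a q"
proof -
  let ?s = "\<lambda>p m. Poly_Mapping.single m (Poly_Mapping.lookup p m)"
  have "p * q = (\<Sum>m\<in>Poly_Mapping.keys p. ?s p m) * (\<Sum>l\<in>Poly_Mapping.keys q. ?s q l)"
    using mpoly_sum_single[of p] mpoly_sum_single[of q] by metis
  also have "\<dots> = (\<Sum>m\<in>Poly_Mapping.keys p. \<Sum>l\<in>Poly_Mapping.keys q. ?s p m * ?s q l)"
    by (rule sum_product)
  finally have "mpoly_eval a (p * q) =
      (\<Sum>m\<in>Poly_Mapping.keys p. \<Sum>l\<in>Poly_Mapping.keys q.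
        (Poly_Mapping.lookup p m * monom_value a m) * (Poly_Mapping.lookup q l * monom_value a l))"
    by (simp add: mpoly_eval_sum mult_single mpoly_eval_single monom_value_add mult_ac)
  also have "\<dots> = mpoly_eval a p * mpoly_eval a q"
    unfolding mpoly_eval_def by (rule sum_product[symmetric])
  finally show ?thesis .
qed

lemma mpolys_one: "1 \<in> mpolys n"
  by (simp add: mpolys_def)

lemma mpolys_mult:
  assumes "p \<in> mpolys n" "q \<in> mpolys n"
  shows "p * q \<in> mpolys n"
  unfolding mpolys_def
proof safe
  fix m i assume "m \<in> Poly_Mapping.keys (p * q)" "i \<in> Poly_Mapping.keys m"
  then obtain u v where "u \<in> Poly_Mapping.keys p" "v \<in> Poly_Mapping.keys q" "m = u + v"
    using keys_mult[of p q] by blast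
  then show "i < n"
    using assms \<open>i \<in> Poly_Mapping.keys m\<close> Poly_Mapping.keys_add[of u v]
    unfolding mpolys_def by blast
qed

lemma istopology_zariski:
  "istopology (\<lambda>U :: 'a::idom list set.
    \<exists>S\<subseteq>mpolys n. U = {a. length a = n} - zero_locus n S)"
  (is "istopology ?L")
  unfolding istopology_def
proof (intro conjI allI impI)
  fix U V assume "?L U" "?L V"
  then obtain S T :: "((nat \<Rightarrow>\<^sub>0 nat) \<Rightarrow>\<^sub>0 'a) set" where
    S: "S \<subseteq> mpolys n" "U = {a. length a = n} - zero_locus n S" and
    T: "T \<subseteq> mpolys n" "V = {a. length a = n} - zero_locus n T"
    by blast
  let ?R = "(\<lambda>(p, q). p * q) ` (S \<times> T)"
  have "?R \<subseteq> mpolys n"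
    using S T by (auto intro: mpolys_mult)
  moreover have "U \<inter> V = {a. length a = n} - zero_locus n ?R"
    using S T by (auto simp: zero_locus_def mpoly_eval_mult)
  ultimately show "?L (U \<inter> V)"
    by blast
next
  fix \<K> assume "\<forall>K\<in>\<K>. ?L K"
  then obtain S where S: "\<And>K. K \<in> \<K> \<Longrightarrow> S K \<subseteq> mpolys n"
    "\<And>K. K \<in> \<K> \<Longrightarrow> K = {a. length a = n} - zero_locus n (S K)"
    by metis
  have "\<Union>\<K> = (\<Union>K\<in>\<K>. {a. length a = n} - zero_locus n (S K))"
    using S(2) by auto
  also have "\<dots> = {a. length a = n} - zero_locus n (\<Union>K\<in>\<K>. S K)"
    by (auto simp: zero_locus_def)
  finally show "?L (\<Union>\<K>)"
    using S(1) by (intro exI[of _ "\<Union>K\<in>\<K>. S K"]) blast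
qed

lemma openin_zariski:
  "openin (zariski n) U \<longleftrightarrow> (\<exists>S\<subseteq>mpolys n. U = {a. length a = n} - zero_locus n S)"
  unfolding zariski_def by (subst topology_inverse'[OF istopology_zariski]) rule

lemma topspace_zariski: "topspace (zariski n) = {a. length a = n}"
proof (rule antisym)
  show "topspace (zariski n) \<subseteq> {a. length a = n}"
    using openin_topspace[of "zariski n"] unfolding openin_zariski by blast
  have "openin (zariski n) {a. length a = n}"
    unfolding openin_zariski
    by (rule exI[of _ "{1}"]) (auto simp: mpolys_one zero_locus_def)
  then show "{a. length a = n} \<subseteq> topspace (zariski n)"
    by (rule openin_subset)
qed


section \<open>The quotient topology on classes\<close>

definition distinct_points :: "nat \<Rightarrow> 'a list set"
  where "distinct_points n = {a. length a = n \<and> distinct a}"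

definition Sigma_topology :: "nat \<Rightarrow> 'a::field set set topology"
  where "Sigma_topology n = topology (\<lambda>U. U \<subseteq> Sigma_classes n \<and>
    openin (subtopology (zariski n) (distinct_points n))
      {a \<in> distinct_points n. pclass (set a) \<in> U})"

lemma Sigma_classes_eq_image: "Sigma_classes n = (\<lambda>a. pclass (set a)) ` distinct_points n"
proof -
  have "n_subsets n = set ` (distinct_points n :: 'a list set)"
  proof (rule antisym)
    show "n_subsets n \<subseteq> set ` (distinct_points n :: 'a list set)"
    proof
      fix A :: "'a set" assume "A \<in> n_subsets n"
      then obtain a where "set a = A" "distinct a" "length a = n"
        unfolding n_subsets_def by (auto dest: finite_distinct_list simp: distinct_card)
      then show "A \<in> set ` distinct_points n"
        unfolding distinct_points_def by blast
    qed
  qed (auto simp: n_subsets_def distinct_points_def distinct_card)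
  then show ?thesis
    by (simp add: Sigma_classes_def image_image)
qed

lemma openin_Sigma_topology:
  fixes U :: "'a::field set set set"
  shows "openin (Sigma_topology n) U \<longleftrightarrow> U \<subseteq> Sigma_classes n \<and>
    openin (subtopology (zariski n) (distinct_points n))
      {a \<in> distinct_points n. pclass (set a) \<in> U}"
proof -
  let ?X = "subtopology (zariski n) (distinct_points n :: 'a list set)"
  let ?pre = "\<lambda>U :: 'a set set set. {a \<in> distinct_points n. pclass (set a) \<in> U}"
  have "istopology (\<lambda>U. U \<subseteq> Sigma_classes n \<and> openin ?X (?pre U))"
    unfolding istopology_def
  proof (intro conjI allI impI)
    fix U V :: "'a set set set" assume "U \<subseteq> Sigma_classes n \<and> openin ?X (?pre U)"
      and "V \<subseteq> Sigma_classes n \<and> openin ?X (?pre V)"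
    moreover have "?pre (U \<inter> V) = ?pre U \<inter> ?pre V"
      by auto
    ultimately show "U \<inter> V \<subseteq> Sigma_classes n" "openin ?X (?pre (U \<inter> V))"
      by auto
  next
    fix \<K> :: "'a set set set set" assume K: "\<forall>K\<in>\<K>. K \<subseteq> Sigma_classes n \<and> openin ?X (?pre K)"
    then show "\<Union>\<K> \<subseteq> Sigma_classes n"
      by blast
    have "?pre (\<Union>\<K>) = (\<Union>K\<in>\<K>. ?pre K)"
      by auto
    then show "openin ?X (?pre (\<Union>\<K>))"
      using K by auto
  qed
  then show ?thesis
    unfolding Sigma_topology_def by (simp add: topology_inverse')
qed

lemma topspace_Sigma_topology: "topspace (Sigma_topology n) = Sigma_classes n"
proof (rule antisym)
  show "topspace (Sigma_topology n) \<subseteq> Sigma_classes n"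
    using openin_topspace[of "Sigma_topology n"] unfolding openin_Sigma_topology by blast
  let ?X = "subtopology (zariski n) (distinct_points n :: 'a list set)"
  have "{a \<in> distinct_points n. pclass (set a) \<in> Sigma_classes n} = topspace ?X"
    by (auto simp: Sigma_classes_eq_image topspace_subtopology topspace_zariski distinct_points_def)
  then have "openin (Sigma_topology n) (Sigma_classes n :: 'a set set set)"
    unfolding openin_Sigma_topology by (metis openin_topspace order_refl)
  then show "(Sigma_classes n :: 'a set set set) \<subseteq> topspace (Sigma_topology n)"
    by (rule openin_subset)
qed

lemma quotient_map_Sigma_topology:
  "quotient_map (subtopology (zariski n) (distinct_points n)) (Sigma_topology n)
    (\<lambda>a. pclass (set a))"
proof -
  have "topspace (subtopology (zariski n) (distinct_points n :: 'a list set)) = distinct_points n"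
    by (auto simp: topspace_subtopology topspace_zariski distinct_points_def)
  then show ?thesis
    unfolding quotient_map_def topspace_Sigma_topology openin_Sigma_topology
    by (auto simp: Sigma_classes_eq_image)
qed

end

theory Submission
  imports Defs
begin

text \<open>
  The antichain is cut out by finitely many linear inequations for each cardinality. Suppose that
  the finite set \<open>A\<close> is the preimage of \<open>B\<close> under a polynomial \<open>P\<close> of degree \<open>d \<ge> 2\<close>, and that \<open>B\<close> has two
  distinct elements \<open>b\<close> and \<open>c\<close>. The polynomials \<open>P - b\<close> and \<open>P - c\<close> agree in degree \<open>d\<close> and,
  because \<open>d \<ge> 2\<close>, also in degree \<open>d - 1\<close>; so by Vieta's formula their roots, counted with
  multiplicity, have the same sum. All these roots lie in \<open>A\<close>, and the two root sets are disjoint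
  and non-empty. Hence the differences of the multiplicities are integers \<open>l a\<close>, not all zero,
  with \<open>(\<Sum>a\<in>A. l a) = 0\<close> and \<open>(\<Sum>a\<in>A. l a * a) = 0\<close>. Counting the zeros of the derivative of
  \<open>P\<close> shows that \<open>d < card A\<close> (\<open>degree_less_card_two_fibres\<close>), so that \<open>\<bar>l a\<bar> \<le> card A\<close>. For
  a given cardinality of \<open>A\<close>, only finitely many coefficient vectors can arise in this way from all
  \<open>B\<close> and \<open>P\<close> together.

  Call an \<open>m\<close>-element set without such a relation, with coefficients bounded by \<open>m\<close>,
  relation-free. If \<open>A\<close> is relation-free and \<open>A \<le>\<^sub>p B\<close> with at least two elements in \<open>B\<close>, then the
  polynomial is linear, so \<open>A\<close> and \<open>B\<close> are equivalent (\<open>relation_free_poly_le_iff_affine\<close>). The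
  classes of relation-free sets with at least two elements therefore form an antichain.

  Since the coefficients sum to zero, affine maps preserve relations, and thus the classes of
  relation-free \<open>m\<close>-element sets pull back to the complement of finitely many hyperplanes in the
  space of \<open>m\<close>-tuples of distinct points, which is open. Relation-free sets exist and can be
  extended by all but finitely many points (\<open>finite_not_relation_free_insert\<close>). If \<open>m \<ge> 3\<close>, the
  set to be extended has at least two points; these leave finitely many choices for an affine map
  between two extensions, so each class contains only finitely many of the extensions, and there
  are as many classes as elements of the field.
\<close>

section \<open>Roots of a polynomial over an algebraically closed field\<close>

lemma sum_mset_eq_sum_count:
  fixes f :: "'a \<Rightarrow> 'b::comm_semiring_1"
  assumes "finite A" "set_mset M \<subseteq> A"
  shows "(\<Sum>x\<in>#M. f x) = (\<Sum>x\<in>A. of_nat (count M x) * f x)"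
  using assms(2)
proof (induction M)
  case (add y M)
  have "(\<Sum>x\<in>A. of_nat (count (add_mset y M) x) * f x) =
      (\<Sum>x\<in>A. of_nat (count M x) * f x + (if x = y then f x else 0))"
    by (intro sum.cong) (auto simp: algebra_simps)
  also have "\<dots> = (\<Sum>x\<in>A. of_nat (count M x) * f x) + f y"
    using add.prems assms(1) by (simp add: sum.distrib sum.delta')
  finally show ?case
    using add by (simp add: add.commute)
qed simp

lemma prod_linear_factors:
  fixes M :: "'a::idom multiset"
  shows "(\<Prod>x\<in>#M. [:-x, 1:]) \<noteq> 0"
    and "degree (\<Prod>x\<in>#M. [:-x, 1:]) = size M"
    and "lead_coeff (\<Prod>x\<in>#M. [:-x, 1:]) = 1"
    and "proots (\<Prod>x\<in>#M. [:-x, 1:]) = M"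
proof -
  show nz: "(\<Prod>x\<in>#M. [:-x, 1:]) \<noteq> 0" for M :: "'a multiset"
    by (induction M) (simp_all del: mult_pCons_left)
  show "degree (\<Prod>x\<in>#M. [:-x, 1:]) = size M"
  proof (induction M)
    case (add x M)
    then show ?case
      using degree_mult_eq[OF _ nz[of M], of "[:-x, 1:]"] by (simp del: mult_pCons_left)
  qed simp
  show "lead_coeff (\<Prod>x\<in>#M. [:-x, 1:]) = 1"
    by (induction M) (simp_all add: lead_coeff_mult del: mult_pCons_left)
  show "proots (\<Prod>x\<in>#M. [:-x, 1:]) = M"
  proof (induction M)
    case (add x M)
    then show ?case
      using proots_mult[OF _ nz[of M], of "[:-x, 1:]"] by (simp del: mult_pCons_left)
  qed simp
qed

text \<open>Vieta's formula for the second-highest coefficient.\<close>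

lemma coeff_prod_linear_factors:
  fixes M :: "'a::idom multiset"
  assumes "M \<noteq> {#}"
  shows "coeff (\<Prod>x\<in>#M. [:-x, 1:]) (size M - 1) = - sum_mset M"
  using assms
proof (induction M)
  case (add x M)
  let ?Q = "\<Prod>x\<in>#M. [:-x, 1:]"
  have top: "coeff ?Q (size M) = 1"
    using prod_linear_factors(2,3)[of M] by simp
  show ?case
  proof (cases "M = {#}")
    case False
    then obtain k where k: "size M = Suc k"
      by (metis size_eq_0_iff_empty not0_implies_Suc)
    then show ?thesis
      using add.IH False top by simp
  qed simp
qed simp

lemma alg_closed_factorization_proots:
  fixes p :: "'a::alg_closed_field poly"
  assumes "p \<noteq> 0"
  shows "size (proots p) = degree p"
    and "p = smult (lead_coeff p) (\<Prod>x\<in>#proots p. [:-x, 1:])"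
proof -
  obtain M where M: "size M = degree p" "p = smult (lead_coeff p) (\<Prod>x\<in>#M. [:-x, 1:])"
    using alg_closed_imp_factorization[OF assms] by blast
  have "proots p = M"
    using M(2) assms by (metis leading_coeff_0_iff proots_smult prod_linear_factors(4))
  with M show "size (proots p) = degree p" "p = smult (lead_coeff p) (\<Prod>x\<in>#proots p. [:-x, 1:])"
    by auto
qed

lemma sum_mset_proots:
  fixes p :: "'a::alg_closed_field poly"
  assumes "degree p > 0"
  shows "coeff p (degree p - 1) = - lead_coeff p * sum_mset (proots p)"
proof -
  have "p \<noteq> 0" using assms by auto
  note f = alg_closed_factorization_proots[OF this]
  have "proots p \<noteq> {#}" using f(1) assms by auto
  from coeff_prod_linear_factors[OF this] f(1)
  have "coeff (\<Prod>x\<in>#proots p. [:-x, 1:]) (degree p - 1) = - sum_mset (proots p)"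
    by simp
  then show ?thesis
    by (subst f(2)) simp
qed

section \<open>Two fibres of a polynomial\<close>

lemma degree_minus_const: "degree (P - [:b:]) = degree (P :: 'a::comm_ring_1 poly)"
proof (cases "degree P = 0")
  case True
  then show ?thesis by (metis degree_diff_le degree_pCons_0 le_zero_eq le_refl)
next
  case False
  then show ?thesis
    using degree_add_eq_left[of "- [:b:]" P] by (simp del: minus_pCons)
qed

text \<open>
  Neither right-hand side depends on \<open>b\<close>: this is what makes two fibres comparable. The sums
  range over a superset \<open>A\<close> of the fibre, so that different fibres can share the index set.
\<close>

lemma fibre_facts:
  fixes P :: "'a::{alg_closed_field, field_char_0} poly"
  assumes "degree P > 0" "finite A" "poly P -` {b} \<subseteq> A"
  shows sum_order_fibre: "(\<Sum>a\<in>A. order a (P - [:b:])) = degree P"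
    and sum_roots_fibre: "degree P \<ge> 2 \<Longrightarrow>
      lead_coeff P * (\<Sum>a\<in>A. of_nat (order a (P - [:b:])) * a) = - coeff P (degree P - 1)"
proof -
  let ?p = "P - [:b:]"
  have deg: "degree ?p = degree P" and lc: "lead_coeff ?p = lead_coeff P"
    using assms(1) by (auto simp: degree_minus_const coeff_pCons split: nat.split)
  have nz: "?p \<noteq> 0" using deg assms(1) by auto
  have sub: "set_mset (proots ?p) \<subseteq> A"
    using assms(3) nz by auto
  show "(\<Sum>a\<in>A. order a ?p) = degree P"
    using sum_mset_eq_sum_count[OF assms(2) sub, of "\<lambda>_. 1::nat"]
      alg_closed_factorization_proots(1)[OF nz] nz deg
    by simp
  assume d2: "degree P \<ge> 2"
  \<comment> \<open>As \<open>degree P - 1 > 0\<close>, subtracting a constant leaves this coefficient alone.\<close>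
  have "coeff ?p (degree P - 1) = coeff P (degree P - 1)"
    using d2 by (auto simp: coeff_pCons split: nat.split)
  then show "lead_coeff P * (\<Sum>a\<in>A. of_nat (order a ?p) * a) = - coeff P (degree P - 1)"
    using sum_mset_eq_sum_count[OF assms(2) sub, of "\<lambda>x. x"] sum_mset_proots[of ?p] nz deg lc assms(1)
    by simp
qed

lemma finite_poly_vimage:
  fixes P :: "'a::idom poly"
  assumes "degree P > 0" "finite B"
  shows "finite (poly P -` B)"
proof -
  have "finite (poly P -` {b})" for b
  proof -
    have "P - [:b:] \<noteq> 0" using assms(1) by auto
    from poly_roots_finite[OF this] show ?thesis
      by (rule finite_subset[rotated]) auto
  qed
  moreover have "poly P -` B = (\<Union>b\<in>B. poly P -` {b})" by auto
  ultimately show ?thesis using assms(2) by auto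
qed

text \<open>
  A point of multiplicity \<open>e\<close> in its fibre is a zero of order \<open>e - 1\<close> of the derivative. The
  multiplicities over two fibres add up to twice the degree, while the derivative has at most
  \<open>degree P - 1\<close> zeros; the difference has to be made up by the number of points.
\<close>

lemma degree_less_card_two_fibres:
  fixes P :: "'a::{alg_closed_field, field_char_0} poly"
  assumes d: "degree P > 0" and b: "b \<noteq> c"
  shows "degree P < card (poly P -` {b, c})"
proof -
  let ?S = "poly P -` {b, c}"
  have fin: "finite ?S" using finite_poly_vimage[OF d] by simp
  have P': "pderiv P \<noteq> 0" using d by (simp add: pderiv_eq_0_iff)
  have der: "pderiv (P - [:e:]) = pderiv P" for e
    by (simp add: pderiv_diff pderiv_pCons)
  have one: "order a (P - [:e:]) = Suc (order a (pderiv P))" if "poly P a = e" for a e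
  proof -
    have "P - [:e:] \<noteq> 0" using d by auto
    then show ?thesis
      using order_pderiv[of "P - [:e:]" a] that der by simp
  qed
  have zero: "order a (P - [:e:]) = 0" if "poly P a \<noteq> e" for a e
    using that by (simp add: order_0I)
  have "2 * degree P = (\<Sum>a\<in>?S. order a (P - [:b:])) + (\<Sum>a\<in>?S. order a (P - [:c:]))"
    by (subst (1 2) sum_order_fibre[OF d fin]) auto
  also have "\<dots> = (\<Sum>a\<in>?S. Suc (order a (pderiv P)))"
    unfolding sum.distrib[symmetric] by (intro sum.cong) (use b one zero in auto)
  also have "\<dots> = card ?S + (\<Sum>a\<in>?S. order a (pderiv P))"
    by (simp add: sum_Suc)
  also have "(\<Sum>a\<in>?S. order a (pderiv P)) \<le> degree (pderiv P)"
  proof -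
    have "(\<Sum>a\<in>?S. order a (pderiv P)) = (\<Sum>a\<in>{a\<in>?S. poly (pderiv P) a = 0}. order a (pderiv P))"
      using fin by (intro sum.mono_neutral_right) (auto simp: P' order_gt_0_iff)
    also have "\<dots> \<le> (\<Sum>a | poly (pderiv P) a = 0. order a (pderiv P))"
      using poly_roots_finite[OF P'] by (intro sum_mono2) auto
    also have "\<dots> \<le> degree (pderiv P)"
      by (rule sum_order_le_degree[OF P'])
    finally show ?thesis .
  qed
  finally show ?thesis
    using d by (simp add: degree_pderiv)
qed

section \<open>Sets without small integral relations\<close>

text \<open>
  The bound \<open>N\<close> leaves finitely many coefficient vectors, so that relation-freeness is an open
  condition; the requirement that the coefficients sum to zero makes it invariant under
  translations.
\<close>

definition relation_free :: "nat \<Rightarrow> 'a::ring_1 set \<Rightarrow> bool"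
  where "relation_free N A \<longleftrightarrow> (\<forall>l :: 'a \<Rightarrow> int.
    (\<forall>x\<in>A. \<bar>l x\<bar> \<le> int N) \<and> (\<Sum>x\<in>A. l x) = 0 \<and> (\<Sum>x\<in>A. of_int (l x) * x) = 0
      \<longrightarrow> (\<forall>x\<in>A. l x = 0))"

lemma relation_free_affine_image:
  fixes A :: "'a::field set"
  assumes "relation_free N A" "u \<noteq> 0"
  shows "relation_free N ((\<lambda>x. u * x + v) ` A)"
  unfolding relation_free_def
proof (intro allI impI)
  let ?g = "\<lambda>x. u * x + v"
  fix l :: "'a \<Rightarrow> int"
  assume l: "(\<forall>y\<in>?g ` A. \<bar>l y\<bar> \<le> int N) \<and> (\<Sum>y\<in>?g ` A. l y) = 0 \<and>
    (\<Sum>y\<in>?g ` A. of_int (l y) * y) = 0"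
  have inj: "inj_on ?g A"
    using assms(2) by (auto simp: inj_on_def)
  have s: "(\<Sum>x\<in>A. l (?g x)) = 0"
    using l by (simp add: sum.reindex[OF inj])
  have "0 = (\<Sum>x\<in>A. of_int (l (?g x)) * ?g x)"
    using l by (simp add: sum.reindex[OF inj])
  also have "\<dots> = u * (\<Sum>x\<in>A. of_int (l (?g x)) * x) + v * of_int (\<Sum>x\<in>A. l (?g x))"
    by (simp add: algebra_simps sum.distrib sum_distrib_left)
  finally have "(\<Sum>x\<in>A. of_int (l (?g x)) * x) = 0"
    using s assms(2) by simp
  then have "\<forall>x\<in>A. l (?g x) = 0"
    using assms(1) l s unfolding relation_free_def by (auto dest!: spec[of _ "\<lambda>x. l (?g x)"])
  then show "\<forall>y\<in>?g ` A. l y = 0" by blast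
qed

text \<open>
  A polynomial of degree at least 2 would produce a forbidden relation: the difference of the
  multiplicities with which a point is a root of \<open>P - b\<close> and of \<open>P - c\<close>.
\<close>

lemma relation_free_vimage_degree:
  fixes P :: "'a::{alg_closed_field, field_char_0} poly"
  assumes d: "degree P > 0" and A: "A = poly P -` B" "finite A" "relation_free (card A) A"
    and B: "b \<in> B" "c \<in> B" "b \<noteq> c"
  shows "degree P = 1"
proof (rule ccontr)
  assume "degree P \<noteq> 1"
  then have d2: "degree P \<ge> 2" using d by simp
  have sub: "poly P -` {b} \<subseteq> A" "poly P -` {c} \<subseteq> A" "poly P -` {b, c} \<subseteq> A"
    using A(1) B by auto
  have small: "degree P \<le> card A"
    using degree_less_card_two_fibres[OF d B(3)] card_mono[OF A(2) sub(3)] by simp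
  define l where "l a = int (order a (P - [:b:])) - int (order a (P - [:c:]))" for a
  have bound: "\<bar>l a\<bar> \<le> int (card A)" for a
  proof -
    have "order a (P - [:e:]) \<le> degree P" for e
    proof -
      have "P - [:e:] \<noteq> 0" using d by auto
      from order_degree[OF this, of a] show ?thesis
        by (simp add: degree_minus_const)
    qed
    then have "int (order a (P - [:b:])) \<le> int (card A)" "int (order a (P - [:c:])) \<le> int (card A)"
      using small by (meson of_nat_le_iff order_trans)+
    then show ?thesis unfolding l_def by linarith
  qed
  have s0: "(\<Sum>a\<in>A. l a) = 0"
    unfolding l_def sum_subtractf of_nat_sum[symmetric]
    by (simp add: sum_order_fibre[OF d A(2)] sub)
  have "lead_coeff P * (\<Sum>a\<in>A. of_int (l a) * a) = 0"
    unfolding l_def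
    using sum_roots_fibre[OF d A(2) sub(1) d2] sum_roots_fibre[OF d A(2) sub(2) d2]
    by (simp add: left_diff_distrib sum_subtractf right_diff_distrib)
  then have s1: "(\<Sum>a\<in>A. of_int (l a) * a) = 0"
    using d by auto
  \<comment> \<open>The relation is nontrivial: a point over \<open>b\<close> is not a root of \<open>P - c\<close>.\<close>
  have "degree (P - [:b:]) > 0"
    using d by (simp add: degree_minus_const)
  then obtain a where "poly (P - [:b:]) a = 0"
    using alg_closed_imp_poly_has_root by blast
  then have a: "poly P a = b" by simp
  have nz: "P - [:b:] \<noteq> 0" using d by auto
  have "order a (P - [:b:]) > 0"
    using a nz by (simp add: order_gt_0_iff)
  moreover have "order a (P - [:c:]) = 0"
    using a B(3) by (intro order_0I) simp
  ultimately have "l a \<noteq> 0"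
    unfolding l_def by simp
  moreover have "a \<in> A" using a A(1) B(1) by simp
  ultimately show False
    using A(3) bound s0 s1 unfolding relation_free_def by blast
qed

lemma affine_image_poly_equiv:
  fixes A :: "'a::field set"
  assumes "u \<noteq> 0"
  shows "A \<equiv>\<^sub>p (\<lambda>x. u * x + v) ` A"
proof -
  have "A = poly [:v, u:] -` ((\<lambda>x. u * x + v) ` A)"
    using assms by (auto simp: algebra_simps)
  moreover have "(\<lambda>x. u * x + v) ` A = poly [:- v / u, 1 / u:] -` A"
  proof (intro equalityI subsetI)
    fix y assume "y \<in> poly [:- v / u, 1 / u:] -` A"
    then have "(y - v) / u \<in> A" by (simp add: diff_divide_distrib)
    moreover have "y = u * ((y - v) / u) + v" using assms by simp
    ultimately show "y \<in> (\<lambda>x. u * x + v) ` A" by blast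
  next
    fix y assume "y \<in> (\<lambda>x. u * x + v) ` A"
    then show "y \<in> poly [:- v / u, 1 / u:] -` A"
      using assms by (auto simp: field_simps)
  qed
  ultimately show ?thesis
    unfolding poly_equiv_def poly_le_def by blast
qed

text \<open>
  Rigidity of relation-free sets, the source of the antichain property: constant polynomials are
  excluded because \<open>A\<close> is finite and non-empty, those of higher degree by the relation that they
  produce, and a linear polynomial is an affine bijection.
\<close>

lemma relation_free_poly_le_iff_affine:
  fixes A :: "'a::{alg_closed_field, field_char_0} set"
  assumes m: "A \<in> n_subsets m" "relation_free m A" "m \<ge> 2" and B: "2 \<le> card B"
  shows "A \<le>\<^sub>p B \<longleftrightarrow> (\<exists>u v. u \<noteq> 0 \<and> B = (\<lambda>x. u * x + v) ` A)"
proof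
  assume le: "A \<le>\<^sub>p B"
  have A: "finite A" "A \<noteq> {}" "relation_free (card A) A"
    using m by (auto simp: n_subsets_def)
  obtain P where P: "A = poly P -` B"
    using le unfolding poly_le_def by blast
  have "finite B" using B by (metis card.infinite not_numeral_le_zero)
  then obtain b c where bc: "b \<in> B" "c \<in> B" "b \<noteq> c"
    using B by (auto simp: card_le_Suc_iff numeral_2_eq_2)
  have "degree P > 0"
  proof (rule ccontr)
    assume "\<not> degree P > 0"
    then obtain e where "P = [:e:]" by (metis degree_eq_zeroE neq0_conv)
    \<comment> \<open>The preimage of a set under a constant polynomial is empty or the whole infinite field.\<close>
    then have "A = {} \<or> A = UNIV" using P by auto
    then show False using A infinite_UNIV_char_0[where 'a = 'a] by auto
  qed
  from relation_free_vimage_degree[OF this P A(1,3) bc] have d: "degree P = 1" .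
  obtain v u where uv: "P = [:v, u:]" "u \<noteq> 0"
  proof -
    obtain v Q where Q: "P = pCons v Q" by (cases P)
    then have "Q \<noteq> 0" "degree Q = 0" using d by (auto split: if_splits)
    then show ?thesis using Q that by (metis degree_eq_zeroE pCons_0_0)
  qed
  have "B = (\<lambda>x. u * x + v) ` A"
  proof (intro equalityI subsetI)
    fix y assume "y \<in> B"
    then have "(y - v) / u \<in> A" using P uv by simp
    moreover have "y = u * ((y - v) / u) + v" using uv by simp
    ultimately show "y \<in> (\<lambda>x. u * x + v) ` A" by blast
  qed (use P uv in \<open>auto simp: algebra_simps\<close>)
  with uv show "\<exists>u v. u \<noteq> 0 \<and> B = (\<lambda>x. u * x + v) ` A"
    by blast
next
  assume "\<exists>u v. u \<noteq> 0 \<and> B = (\<lambda>x. u * x + v) ` A"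
  then show "A \<le>\<^sub>p B"
    using affine_image_poly_equiv unfolding poly_equiv_def by blast
qed

text \<open>
  If \<open>t\<close> is not in \<open>B\<close>, it has a nonzero coefficient in every relation on \<open>insert t B\<close>, since \<open>B\<close>
  alone has no relation. So \<open>t\<close> can be computed from the coefficients, of which there are finitely
  many.
\<close>

lemma finite_not_relation_free_insert:
  fixes B :: "'a::field_char_0 set"
  assumes "finite B" "relation_free N B"
  shows "finite {t. \<not> relation_free N (insert t B)}"
proof -
  let ?L = "(B \<rightarrow>\<^sub>E {-int N..int N}) \<times> {-int N..int N}"
  let ?g = "\<lambda>(l, k). - (\<Sum>x\<in>B. of_int (l x) * x) / of_int k :: 'a"
  have "t \<in> B \<union> ?g ` ?L" if t: "\<not> relation_free N (insert t B)" for t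
  proof (rule UnCI)
    assume tB: "t \<notin> ?g ` ?L"
    show "t \<in> B"
    proof (rule ccontr)
      assume nB: "t \<notin> B"
      obtain l where l: "\<forall>x\<in>insert t B. \<bar>l x\<bar> \<le> int N" "(\<Sum>x\<in>insert t B. l x) = 0"
        "(\<Sum>x\<in>insert t B. of_int (l x) * x) = 0" "\<exists>x\<in>insert t B. l x \<noteq> 0"
        using t unfolding relation_free_def by blast
      have s: "l t + (\<Sum>x\<in>B. l x) = 0" "of_int (l t) * t + (\<Sum>x\<in>B. of_int (l x) * x) = 0"
        using l nB assms(1) by simp_all
      show False
      proof (cases "l t = 0")
        case True
        then show False
          using assms(2) l s unfolding relation_free_def by auto
      next
        case False
        then have "t = ?g (restrict l B, l t)"
          using s(2) by (simp add: field_simps eq_neg_iff_add_eq_0)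
        moreover have "(restrict l B, l t) \<in> ?L"
          using l(1) by (auto simp: abs_le_iff intro: minus_le_iff[THEN iffD1])
        ultimately show False using tB by blast
      qed
    qed
  qed
  then have sub: "{t. \<not> relation_free N (insert t B)} \<subseteq> B \<union> ?g ` ?L"
    by (intro subsetI) (drule CollectD, assumption)
  have "finite (B \<union> ?g ` ?L)"
    using assms(1) by (intro finite_UnI finite_imageI finite_cartesian_product finite_PiE) auto
  then show ?thesis
    using sub by (rule rev_finite_subset)
qed

lemma exists_relation_free:
  "\<exists>A :: 'a::field_char_0 set. finite A \<and> card A = n \<and> relation_free N A"
proof (induction n)
  case 0
  show ?case by (rule exI[of _ "{}"]) (simp add: relation_free_def)
next
  case (Suc n)
  then obtain A :: "'a set" where A: "finite A" "card A = n" "relation_free N A" by blast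
  have "finite (A \<union> {t. \<not> relation_free N (insert t A)})"
    using A finite_not_relation_free_insert by blast
  then obtain t where "t \<notin> A" "relation_free N (insert t A)"
    using ex_new_if_finite[OF infinite_UNIV_char_0] by blast
  with A show ?case by (intro exI[of _ "insert t A"]) auto
qed

section \<open>Openness of the relation-free locus\<close>

definition linear_form :: "nat \<Rightarrow> (nat \<Rightarrow> 'a) \<Rightarrow> ((nat \<Rightarrow>\<^sub>0 nat) \<Rightarrow>\<^sub>0 'a::comm_ring_1)"
  where "linear_form n c = (\<Sum>i<n. Poly_Mapping.single (Poly_Mapping.single i 1) (c i))"

lemma mpoly_eval_linear_form: "mpoly_eval a (linear_form n c) = (\<Sum>i<n. c i * a ! i)"
  by (simp add: linear_form_def mpoly_eval_sum mpoly_eval_single monom_value_def)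

lemma linear_form_mpolys: "linear_form n c \<in> mpolys n"
proof -
  have "Poly_Mapping.keys (linear_form n c) \<subseteq> (\<lambda>i. Poly_Mapping.single i 1) ` {..<n}"
    unfolding linear_form_def
    by (rule order_trans[OF keys_sum]) (auto split: if_splits)
  then show ?thesis
    unfolding mpolys_def by auto
qed

lemma openin_linear_form_nonzero:
  "openin (zariski n) {a :: 'a::idom list. length a = n \<and> (\<Sum>i<n. c i * a ! i) \<noteq> 0}"
  unfolding openin_zariski
  by (rule exI[of _ "{linear_form n c}"])
    (auto simp: linear_form_mpolys zero_locus_def mpoly_eval_linear_form)

text \<open>
  Indexing the coefficients by positions instead of points turns relation-freeness into a
  condition on the coordinates, with one inequation for each element of a fixed finite set.
\<close>

lemma relation_free_set_iff:
  fixes a :: "'a::comm_ring_1 list"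
  assumes "distinct a"
  defines "n \<equiv> length a"
  shows "relation_free N (set a) \<longleftrightarrow>
    (\<forall>l \<in> {..<n} \<rightarrow>\<^sub>E {-int N..int N}. (\<Sum>i<n. l i) = 0 \<and> (\<exists>i<n. l i \<noteq> 0)
      \<longrightarrow> (\<Sum>i<n. of_int (l i) * a ! i) \<noteq> 0)"
    (is "_ \<longleftrightarrow> ?R")
proof -
  have bij: "bij_betw ((!) a) {..<n} (set a)"
    using assms by (simp add: bij_betw_nth n_def)
  have reindex: "(\<Sum>x\<in>set a. f x) = (\<Sum>i<n. f (a ! i))" for f :: "'a \<Rightarrow> 'b::comm_monoid_add"
    by (rule sum.reindex_bij_betw[OF bij, symmetric])
  have all: "(\<forall>x\<in>set a. Q x) \<longleftrightarrow> (\<forall>i<n. Q (a ! i))" for Q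
    by (simp add: all_set_conv_all_nth n_def)
  show ?thesis
  proof
    assume rf: "relation_free N (set a)"
    show ?R
    proof (intro ballI impI notI)
      fix l assume l: "l \<in> {..<n} \<rightarrow>\<^sub>E {-int N..int N}" "(\<Sum>i<n. l i) = 0 \<and> (\<exists>i<n. l i \<noteq> 0)"
        and s: "(\<Sum>i<n. of_int (l i) * a ! i) = 0"
      define l' where "l' = l \<circ> the_inv_into {..<n} ((!) a)"
      have l': "l' (a ! i) = l i" if "i < n" for i
        using bij that by (simp add: l'_def the_inv_into_f_f bij_betw_def)
      have "\<bar>l i\<bar> \<le> int N" if "i < n" for i
      proof -
        have "l i \<in> {-int N..int N}" using l(1) by (rule PiE_mem) (simp add: that)
        then show ?thesis by auto
      qed
      then have "\<forall>x\<in>set a. \<bar>l' x\<bar> \<le> int N"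
        by (simp add: all l')
      moreover have "(\<Sum>x\<in>set a. l' x) = 0" "(\<Sum>x\<in>set a. of_int (l' x) * x) = 0"
        using l(2) s by (simp_all add: reindex l')
      ultimately have "\<forall>x\<in>set a. l' x = 0"
        using rf unfolding relation_free_def by blast
      then show False
        using l(2) l' by (auto simp: all)
    qed
  next
    assume R: ?R
    show "relation_free N (set a)"
      unfolding relation_free_def
    proof (intro allI impI, rule ccontr)
      fix l :: "'a \<Rightarrow> int"
      assume l: "(\<forall>x\<in>set a. \<bar>l x\<bar> \<le> int N) \<and> sum l (set a) = 0 \<and> (\<Sum>x\<in>set a. of_int (l x) * x) = 0"
        and nz: "\<not> (\<forall>x\<in>set a. l x = 0)"
      let ?l = "restrict (\<lambda>i. l (a ! i)) {..<n}"
      have "?l \<in> {..<n} \<rightarrow>\<^sub>E {-int N..int N}"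
        using l by (force simp: all abs_le_iff)
      moreover obtain i where "i < n" "l (a ! i) \<noteq> 0"
        using nz unfolding all by blast
      then have "\<exists>i<n. ?l i \<noteq> 0"
        by (intro exI[of _ i]) simp
      moreover have "(\<Sum>i<n. ?l i) = 0" "(\<Sum>i<n. of_int (?l i) * a ! i) = 0"
        using l by (simp_all add: reindex)
      ultimately show False
        using R by blast
    qed
  qed
qed

lemma openin_relation_free:
  "openin (subtopology (zariski n) (distinct_points n))
    {a \<in> distinct_points n. relation_free N (set (a :: 'a::idom list))}"
proof -
  let ?L = "{l \<in> {..<n} \<rightarrow>\<^sub>E {-int N..int N}. (\<Sum>i<n. l i) = 0 \<and> (\<exists>i<n. l i \<noteq> 0)}"
  let ?W = "\<lambda>l. {a :: 'a list. length a = n \<and> (\<Sum>i<n. of_int (l i) * a ! i) \<noteq> 0}"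
  have "finite ?L"
    by (rule finite_subset[of _ "{..<n} \<rightarrow>\<^sub>E {-int N..int N}"]) (auto intro: finite_PiE)
  then have "openin (zariski n) (topspace (zariski n) \<inter> \<Inter>(?W ` ?L))"
  proof (intro openin_Int_Inter)
    show "openin (zariski n) X" if "X \<in> ?W ` ?L" for X
      using that by (elim imageE) (simp only: openin_linear_form_nonzero)
  qed simp_all
  moreover have "{a \<in> distinct_points n. relation_free N (set (a :: 'a list))} =
      (topspace (zariski n) \<inter> \<Inter>(?W ` ?L)) \<inter> distinct_points n"
  proof (intro set_eqI iffI)
    fix a :: "'a list" assume "a \<in> {a \<in> distinct_points n. relation_free N (set a)}"
    then have a: "a \<in> distinct_points n" "length a = n"
      and rf: "\<forall>l\<in>?L. (\<Sum>i<n. of_int (l i) * a ! i) \<noteq> 0"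
      using relation_free_set_iff[of a N] unfolding distinct_points_def by blast+
    then show "a \<in> (topspace (zariski n) \<inter> \<Inter>(?W ` ?L)) \<inter> distinct_points n"
      unfolding topspace_zariski by blast
  next
    fix a :: "'a list" assume "a \<in> (topspace (zariski n) \<inter> \<Inter>(?W ` ?L)) \<inter> distinct_points n"
    then have a: "a \<in> distinct_points n" "distinct a" "length a = n"
      and "\<forall>l\<in>?L. (\<Sum>i<n. of_int (l i) * a ! i) \<noteq> 0"
      unfolding distinct_points_def by blast+
    then show "a \<in> {a \<in> distinct_points n. relation_free N (set a)}"
      using relation_free_set_iff[of a N] by blast
  qed
  ultimately show ?thesis
    unfolding openin_subtopology by blast
qed

definition relation_free_classes :: "nat \<Rightarrow> 'a::field set set set"
  where "relation_free_classes m = pclass ` {A \<in> n_subsets m. relation_free m A}"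

text \<open>
  The preimage in the space of tuples contains, a priori, every tuple whose set of entries is
  equivalent to some relation-free set. By rigidity this equivalence is affine, so the entries
  themselves are relation-free and the preimage is the open locus found above.
\<close>

lemma openin_relation_free_classes:
  assumes "m \<ge> 2"
  shows "openin (Sigma_topology m)
    (relation_free_classes m :: 'a::{alg_closed_field, field_char_0} set set set)"
proof -
  have "{a \<in> distinct_points m. pclass (set a) \<in> (relation_free_classes m :: 'a set set set)} =
      {a \<in> distinct_points m. relation_free m (set a)}"
  proof (intro equalityI subsetI)
    fix a :: "'a list" assume "a \<in> {a \<in> distinct_points m. pclass (set a) \<in> relation_free_classes m}"
    then obtain A where a: "a \<in> distinct_points m" and
      A: "A \<in> n_subsets m" "relation_free m A" "pclass (set a) = pclass A"
      unfolding relation_free_classes_def by blast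
    have "card (set a) = m"
      using a by (auto simp: distinct_points_def distinct_card)
    moreover have "A \<le>\<^sub>p set a"
      using A(3) unfolding pclass_eq_iff poly_equiv_def by simp
    ultimately obtain u v where "u \<noteq> 0" "set a = (\<lambda>x. u * x + v) ` A"
      using relation_free_poly_le_iff_affine[OF A(1,2) assms, of "set a"] assms by auto
    then show "a \<in> {a \<in> distinct_points m. relation_free m (set a)}"
      using a relation_free_affine_image[OF A(2)] by simp
  next
    fix a :: "'a list" assume "a \<in> {a \<in> distinct_points m. relation_free m (set a)}"
    then show "a \<in> {a \<in> distinct_points m. pclass (set a) \<in> relation_free_classes m}"
      by (auto simp: relation_free_classes_def distinct_points_def n_subsets_def distinct_card)
  qed
  moreover have "relation_free_classes m \<subseteq> (Sigma_classes m :: 'a set set set)"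
    unfolding relation_free_classes_def Sigma_classes_def by blast
  ultimately show ?thesis
    unfolding openin_Sigma_topology using openin_relation_free by simp
qed

section \<open>The number of classes\<close>

lemma UN_lepoll_infinite:
  assumes "infinite B" "I \<lesssim> B" "\<And>i. i \<in> I \<Longrightarrow> A i \<lesssim> B"
  shows "(\<Union>i\<in>I. A i) \<lesssim> B"
  using card_of_UNION_ordLeq_infinite[of B I A] assms
  unfolding lepoll_def by (simp add: card_of_ordLeq)

lemma finite_fibres_lepoll_image:
  assumes "infinite T" "\<And>x. x \<in> T \<Longrightarrow> finite {y \<in> T. f y = f x}"
  shows "T \<lesssim> f ` T"
proof -
  have T: "T = (\<Union>z\<in>f ` T. {y \<in> T. f y = z})" by auto
  have "infinite (f ` T)"
  proof
    assume "finite (f ` T)"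
    then have "finite (\<Union>z\<in>f ` T. {y \<in> T. f y = z})"
      using assms(2) by (intro finite_UN_I) auto
    with T assms(1) show False by simp
  qed
  then have "(\<Union>z\<in>f ` T. {y \<in> T. f y = z}) \<lesssim> f ` T"
    using assms(2) by (intro UN_lepoll_infinite) (auto intro: finite_lepoll_infinite)
  with T show ?thesis by simp
qed

lemma lists_length_lepoll:
  assumes "infinite (UNIV :: 'a set)"
  shows "{xs :: 'a list. length xs = n} \<lesssim> (UNIV :: 'a set)"
proof (induction n)
  case 0
  show ?case by (simp add: assms finite_lepoll_infinite)
next
  case (Suc n)
  have "{xs :: 'a list. length xs = Suc n} = (\<Union>x. (#) x ` {xs. length xs = n})"
    by (auto simp: length_Suc_conv)
  moreover have "(#) x ` {xs :: 'a list. length xs = n} \<lesssim> (UNIV :: 'a set)" for x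
    using image_lepoll Suc by (rule lepoll_trans)
  then have "(\<Union>x. (#) x ` {xs :: 'a list. length xs = n}) \<lesssim> (UNIV :: 'a set)"
    by (rule UN_lepoll_infinite[OF assms lepoll_refl])
  ultimately show ?case by simp
qed

lemma Sigma_classes_lepoll:
  "(Sigma_classes m :: 'a::field_char_0 set set set) \<lesssim> (UNIV :: 'a set)"
proof -
  have "(Sigma_classes m :: 'a set set set) \<lesssim> (distinct_points m :: 'a list set)"
    unfolding Sigma_classes_eq_image by (rule image_lepoll)
  also have "(distinct_points m :: 'a list set) \<lesssim> {xs :: 'a list. length xs = m}"
    by (rule subset_imp_lepoll) (auto simp: distinct_points_def)
  also have "\<dots> \<lesssim> (UNIV :: 'a set)"
    by (rule lists_length_lepoll[OF infinite_UNIV_char_0])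
  finally show ?thesis .
qed

text \<open>
  The affine map is determined by the points that it sends to \<open>b\<close> and \<open>c\<close>; once these are chosen
  in \<open>A\<close>, the point \<open>t\<close> is determined by its own preimage in \<open>A\<close>.
\<close>

lemma finite_affine_extensions:
  fixes B A :: "'a::field set"
  assumes "finite A" and B: "b \<in> B" "c \<in> B" "b \<noteq> c"
  shows "finite {t. \<exists>u v. u \<noteq> 0 \<and> insert t B = (\<lambda>x. u * x + v) ` A}"
proof -
  let ?g = "\<lambda>(x, y, z). b + (b - c) / (x - y) * (z - x)"
  have "t \<in> ?g ` (A \<times> A \<times> A)" if "u \<noteq> 0" and eq: "insert t B = (\<lambda>x. u * x + v) ` A" for t u v
  proof -
    have "b \<in> (\<lambda>x. u * x + v) ` A" "c \<in> (\<lambda>x. u * x + v) ` A" "t \<in> (\<lambda>x. u * x + v) ` A"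
      using B unfolding eq[symmetric] by simp_all
    then obtain x y z where xyz: "x \<in> A" "y \<in> A" "z \<in> A"
      "b = u * x + v" "c = u * y + v" "t = u * z + v"
      by (elim imageE)
    then have "x \<noteq> y" using B by auto
    then have u: "(b - c) / (x - y) = u" using xyz by (simp add: field_simps)
    have "t = b + u * (z - x)" using xyz by (simp add: algebra_simps)
    then have "t = ?g (x, y, z)" unfolding prod.case u .
    with xyz show ?thesis by blast
  qed
  then have "{t. \<exists>u v. u \<noteq> 0 \<and> insert t B = (\<lambda>x. u * x + v) ` A} \<subseteq> ?g ` (A \<times> A \<times> A)"
    by blast
  then show ?thesis
    using assms(1) by (meson finite_SigmaI finite_imageI finite_subset)
qed

text \<open>
  One point of a relation-free set is moved while the others, at least two of them, stay fixed.
\<close>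

lemma lepoll_relation_free_classes:
  assumes "m \<ge> 3"
  shows "(UNIV :: 'a::{alg_closed_field, field_char_0} set) \<lesssim> (relation_free_classes m :: 'a set set set)"
proof -
  obtain B :: "'a set" where B: "finite B" "card B = m - 1" "relation_free m B"
    using exists_relation_free by blast
  define E where "E = B \<union> {t. \<not> relation_free m (insert t B)}"
  have "finite E"
    unfolding E_def using B finite_not_relation_free_insert by blast
  then have inf: "infinite (- E)"
    using infinite_UNIV_char_0 by (metis finite_compl)
  have sets: "insert t B \<in> n_subsets m" "relation_free m (insert t B)" if "t \<in> - E" for t
    using that B assms by (auto simp: E_def n_subsets_def)
  have "2 \<le> card B" using B assms by simp
  then obtain b c where bc: "b \<in> B" "c \<in> B" "b \<noteq> c"
    using B(1) by (auto simp: card_le_Suc_iff numeral_2_eq_2)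
  define \<phi> where "\<phi> t = pclass (insert t B)" for t
  have fib: "finite {s \<in> - E. \<phi> s = \<phi> t}" if t: "t \<in> - E" for t
  proof (rule finite_subset)
    show "finite {s. \<exists>u v. u \<noteq> 0 \<and> insert s B = (\<lambda>x. u * x + v) ` insert t B}"
      by (rule finite_affine_extensions[OF _ bc]) (use B in simp)
    show "{s \<in> - E. \<phi> s = \<phi> t} \<subseteq>
        {s. \<exists>u v. u \<noteq> 0 \<and> insert s B = (\<lambda>x. u * x + v) ` insert t B}"
    proof clarify
      fix s assume s: "s \<notin> E" "\<phi> s = \<phi> t"
      then have "insert t B \<le>\<^sub>p insert s B"
        by (simp add: \<phi>_def pclass_eq_iff poly_equiv_def)
      moreover have "2 \<le> card (insert s B)"
        using sets(1)[of s] s assms by (auto simp: n_subsets_def)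
      ultimately show "\<exists>u v. u \<noteq> 0 \<and> insert s B = (\<lambda>x. u * x + v) ` insert t B"
        using relation_free_poly_le_iff_affine[OF sets[OF t]] assms by auto
    qed
  qed
  have "(UNIV :: 'a set) \<lesssim> - E"
  proof -
    \<comment> \<open>The field is the union of two sets, each of which embeds into \<open>- E\<close>.\<close>
    have "E \<lesssim> - E" using \<open>finite E\<close> inf by (rule finite_lepoll_infinite[rotated])
    then have "(\<Union>i\<in>{True, False}. if i then E else - E) \<lesssim> - E"
      using inf by (intro UN_lepoll_infinite) (auto intro: finite_lepoll_infinite)
    then show ?thesis by (simp add: Compl_partition)
  qed
  also have "- E \<lesssim> \<phi> ` (- E)"
    using finite_fibres_lepoll_image[OF inf fib] .
  also have "\<phi> ` (- E) \<lesssim> (relation_free_classes m :: 'a set set set)"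
    by (rule subset_imp_lepoll) (use sets in \<open>auto simp: \<phi>_def relation_free_classes_def\<close>)
  finally show ?thesis .
qed

section \<open>The antichain\<close>

lemma pantichain_relation_free_classes:
  "pantichain (\<Union>m\<in>{2..}. relation_free_classes m :: 'a::{alg_closed_field, field_char_0} set set set)"
proof -
  have "X = Y" if X: "X \<in> relation_free_classes m" "m \<ge> 2" and Y: "Y \<in> relation_free_classes n" "n \<ge> 2"
    and le: "pclass_le X Y" for X Y :: "'a set set" and m n
  proof -
    obtain A where A: "A \<in> n_subsets m" "relation_free m A" "X = pclass A"
      using X(1) unfolding relation_free_classes_def by blast
    obtain B where B: "B \<in> n_subsets n" "Y = pclass B"
      using Y(1) unfolding relation_free_classes_def by blast
    have "A \<le>\<^sub>p B" using A B le by (simp add: pclass_le_iff)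
    then obtain u v where "u \<noteq> 0" "B = (\<lambda>x. u * x + v) ` A"
      using relation_free_poly_le_iff_affine[OF A(1,2), of B] B X Y by (auto simp: n_subsets_def)
    then show "X = Y"
      using affine_image_poly_equiv A B by (simp add: pclass_eq_iff)
  qed
  then show ?thesis
    unfolding pantichain_def by (metis UN_E atLeast_iff)
qed

theorem theorem47:
  shows "\<exists>\<C> :: 'a::{alg_closed_field, field_char_0} set set set.
    pantichain \<C> \<and>
    \<C> \<subseteq> (\<Union>m\<in>{2..}. Sigma_classes m) \<and>
    (\<forall>m\<ge>2. \<exists>U. openin (Sigma_topology m) U \<and> U \<noteq> {} \<and> U \<subseteq> \<C> \<inter> Sigma_classes m) \<and>
    (\<forall>m\<ge>3. \<C> \<inter> Sigma_classes m \<approx> (UNIV :: 'a set))"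
proof (intro exI conjI allI impI)
  let ?C = "\<Union>m\<in>{2..}. relation_free_classes m :: 'a set set set"
  have sub: "relation_free_classes m \<subseteq> (Sigma_classes m :: 'a set set set)" for m
    unfolding relation_free_classes_def Sigma_classes_def by blast
  show "pantichain ?C"
    by (rule pantichain_relation_free_classes)
  show "?C \<subseteq> (\<Union>m\<in>{2..}. Sigma_classes m)"
    using sub by blast
  show "openin (Sigma_topology m) (relation_free_classes m :: 'a set set set)" if "m \<ge> 2" for m
    using that by (rule openin_relation_free_classes)
  show "relation_free_classes m \<noteq> ({} :: 'a set set set)" for m
    using exists_relation_free[of m m] by (auto simp: relation_free_classes_def n_subsets_def)
  show "relation_free_classes m \<subseteq> ?C \<inter> Sigma_classes m" if "m \<ge> 2" for m
    using that sub by auto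
  show "?C \<inter> Sigma_classes m \<approx> (UNIV :: 'a set)" if "m \<ge> 3" for m
  proof (rule lepoll_antisym)
    show "?C \<inter> Sigma_classes m \<lesssim> (UNIV :: 'a set)"
      by (rule lepoll_trans[OF subset_imp_lepoll[OF Int_lower2] Sigma_classes_lepoll])
    have "relation_free_classes m \<subseteq> ?C \<inter> Sigma_classes m"
      by (intro Int_greatest UN_upper sub) (use that in simp)
    then show "(UNIV :: 'a set) \<lesssim> ?C \<inter> Sigma_classes m"
      by (rule lepoll_trans[OF lepoll_relation_free_classes[OF that] subset_imp_lepoll])
  qed
qed

end
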